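(* (In $\mathsf{ZF}$.) Every $\mathrm{H}_2$-finite set is $\mathrm{R}^2$-finite.
   Context: Work in $\mathsf{ZF}$, without the Axiom of Choice. A set is finite if it is in bijection with some $n\in\omega$, and infinite otherwise. $[X]^2$ is the set of two-element subsets of $X$, $[X]^{<\omega}$ the set of all finite subsets of $X$, and $2=\{0,1\}$. $[X]^{<\omega}$ is a group under symmetric difference $\bigtriangleup$; for $Y\subseteq[X]^{<\omega}$, $\mathrm{FS}_{\leq 2}(Y)=\{\sum_{y\in F}y : F\subseteq Y,\ 0<|F|\leq 2\}$, with sums computed with respect to $\bigtriangleup$. A set $X$ is $\mathrm{H}_2$-finite if there is a colouring $c:[X]^{<\omega}\to 2$ such that for every infinite $Y\subseteq[X]^{<\omega}$ the colouring $c$ is not constant on $\mathrm{FS}_{\leq 2}(Y)$. A set $X$ is $\mathrm{R}^2$-finite if there is a colouring $c:[X]^2\to 2$ such that for every infinite $Y\subseteq X$ the restriction $c\upharpoonright[Y]^2$ is not constant. *)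

theory Defs
  imports Main
begin

text \<open>
  HOL has the choice operator, so a theorem of ZF cannot be stated about HOL sets: for those, both
  finiteness notions below collapse to ordinary finiteness. The theorem is instead stated about an
  arbitrary model of first-order ZF, that is, a binary relation on the elements of a type \<open>'m\<close>.
  Every notion of the paper is interpreted inside the model, with quantifiers ranging over \<open>'m\<close>.
\<close>

datatype fm = Mem nat nat | Equal nat nat | Neg fm | Conj fm fm | All nat fm

primrec sat :: "('m \<Rightarrow> 'm \<Rightarrow> bool) \<Rightarrow> (nat \<Rightarrow> 'm) \<Rightarrow> fm \<Rightarrow> bool" where
  "sat E v (Mem i j) = E (v i) (v j)"
| "sat E v (Equal i j) = (v i = v j)"
| "sat E v (Neg p) = (\<not> sat E v p)"
| "sat E v (Conj p q) = (sat E v p \<and> sat E v q)"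
| "sat E v (All i p) = (\<forall>a. sat E (v(i := a)) p)"

locale set_structure =
  fixes mem :: "'m \<Rightarrow> 'm \<Rightarrow> bool" (infix \<open>\<epsilon>\<close> 50)
begin

text \<open>
  There are no term-forming operations: \<open>is_t \<dots> z\<close> says that \<open>z\<close> is the set denoted by the term
  \<open>t\<close>, and a statement about \<open>t\<close> is rendered as \<open>\<exists>z. is_t \<dots> z \<and> \<dots>\<close>. All these sets exist, uniquely,
  in models of ZF.
\<close>

definition subset :: "'m \<Rightarrow> 'm \<Rightarrow> bool" where
  "subset x y \<longleftrightarrow> (\<forall>z. z \<epsilon> x \<longrightarrow> z \<epsilon> y)"

definition is_empty :: "'m \<Rightarrow> bool" where
  "is_empty x \<longleftrightarrow> (\<forall>z. \<not> z \<epsilon> x)"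

definition is_upair :: "'m \<Rightarrow> 'm \<Rightarrow> 'm \<Rightarrow> bool" where
  "is_upair a b p \<longleftrightarrow> (\<forall>z. z \<epsilon> p \<longleftrightarrow> z = a \<or> z = b)"

definition is_opair :: "'m \<Rightarrow> 'm \<Rightarrow> 'm \<Rightarrow> bool" where
  "is_opair a b p \<longleftrightarrow> (\<exists>s d. is_upair a a s \<and> is_upair a b d \<and> is_upair s d p)"

definition is_succ :: "'m \<Rightarrow> 'm \<Rightarrow> bool" where
  "is_succ x y \<longleftrightarrow> (\<forall>z. z \<epsilon> y \<longleftrightarrow> z \<epsilon> x \<or> z = x)"

definition is_inductive :: "'m \<Rightarrow> bool" where
  "is_inductive w \<longleftrightarrow>
     (\<exists>e. is_empty e \<and> e \<epsilon> w) \<and> (\<forall>x. x \<epsilon> w \<longrightarrow> (\<exists>y. is_succ x y \<and> y \<epsilon> w))"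

text \<open>Membership in \<open>\<omega>\<close>, the least inductive set:\<close>

definition in_omega :: "'m \<Rightarrow> bool" where
  "in_omega n \<longleftrightarrow> (\<forall>w. is_inductive w \<longrightarrow> n \<epsilon> w)"

definition is_two :: "'m \<Rightarrow> bool" where
  "is_two t \<longleftrightarrow> (\<exists>z u. is_empty z \<and> is_upair z z u \<and> is_upair z u t)"

definition maps_to :: "'m \<Rightarrow> 'm \<Rightarrow> 'm \<Rightarrow> bool" where
  "maps_to f a b \<longleftrightarrow> (\<exists>p. is_opair a b p \<and> p \<epsilon> f)"

definition is_function :: "'m \<Rightarrow> 'm \<Rightarrow> 'm \<Rightarrow> bool" where
  "is_function f x y \<longleftrightarrow>
     (\<forall>p. p \<epsilon> f \<longrightarrow> (\<exists>a b. a \<epsilon> x \<and> b \<epsilon> y \<and> is_opair a b p)) \<and>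
     (\<forall>a. a \<epsilon> x \<longrightarrow> (\<exists>!b. maps_to f a b))"

definition is_bijection :: "'m \<Rightarrow> 'm \<Rightarrow> 'm \<Rightarrow> bool" where
  "is_bijection f x y \<longleftrightarrow>
     is_function f x y \<and> (\<forall>b. b \<epsilon> y \<longrightarrow> (\<exists>!a. maps_to f a b))"

definition is_finite :: "'m \<Rightarrow> bool" where
  "is_finite x \<longleftrightarrow> (\<exists>n f. in_omega n \<and> is_bijection f x n)"

definition is_pairs :: "'m \<Rightarrow> 'm \<Rightarrow> bool" \<comment> \<open>\<open>D = [X]\<^sup>2\<close>\<close> where
  "is_pairs X D \<longleftrightarrow>
     (\<forall>z. z \<epsilon> D \<longleftrightarrow> subset z X \<and> (\<exists>a b. a \<noteq> b \<and> is_upair a b z))"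

definition is_finsets :: "'m \<Rightarrow> 'm \<Rightarrow> bool" \<comment> \<open>\<open>P\<close> is the set of finite subsets of \<open>X\<close>\<close> where
  "is_finsets X P \<longleftrightarrow> (\<forall>z. z \<epsilon> P \<longleftrightarrow> subset z X \<and> is_finite z)"

definition is_symdiff :: "'m \<Rightarrow> 'm \<Rightarrow> 'm \<Rightarrow> bool" where
  "is_symdiff x y s \<longleftrightarrow> (\<forall>u. u \<epsilon> s \<longleftrightarrow> (u \<epsilon> x \<and> \<not> u \<epsilon> y) \<or> (u \<epsilon> y \<and> \<not> u \<epsilon> x))"

text \<open>\<open>F\<close> has one or two elements, and \<open>s\<close> is their sum with respect to symmetric difference:\<close>

definition is_sum_le2 :: "'m \<Rightarrow> 'm \<Rightarrow> bool" where
  "is_sum_le2 F s \<longleftrightarrow>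
     (\<exists>y. is_upair y y F \<and> s = y) \<or>
     (\<exists>y y'. y \<noteq> y' \<and> is_upair y y' F \<and> is_symdiff y y' s)"

definition is_FS_le2 :: "'m \<Rightarrow> 'm \<Rightarrow> bool" where
  "is_FS_le2 Y S \<longleftrightarrow> (\<forall>s. s \<epsilon> S \<longleftrightarrow> (\<exists>F. subset F Y \<and> is_sum_le2 F s))"

definition is_colouring :: "'m \<Rightarrow> 'm \<Rightarrow> bool" where
  "is_colouring c D \<longleftrightarrow> (\<exists>t. is_two t \<and> is_function c D t)"

definition constant_on :: "'m \<Rightarrow> 'm \<Rightarrow> bool" where
  "constant_on c S \<longleftrightarrow> (\<exists>k. \<forall>s. s \<epsilon> S \<longrightarrow> maps_to c s k)"

definition H2_finite :: "'m \<Rightarrow> bool" where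
  "H2_finite X \<longleftrightarrow>
     (\<exists>P. is_finsets X P \<and>
       (\<exists>c. is_colouring c P \<and>
         (\<forall>Y. subset Y P \<and> \<not> is_finite Y \<longrightarrow>
           (\<exists>S. is_FS_le2 Y S \<and> \<not> constant_on c S))))"

definition R2_finite :: "'m \<Rightarrow> bool" where
  "R2_finite X \<longleftrightarrow>
     (\<exists>D. is_pairs X D \<and>
       (\<exists>c. is_colouring c D \<and>
         (\<forall>Y. subset Y X \<and> \<not> is_finite Y \<longrightarrow>
           (\<exists>S. is_pairs Y S \<and> \<not> constant_on c S))))"

end

text \<open>
  The two schemas range over first-order formulas, with the valuation \<open>v\<close> supplying the parameters.
  Allowing arbitrary HOL predicates instead would make every model satisfy the Axiom of Choice,
  by replacement along a HOL choice function.
\<close>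

locale ZF = set_structure +
  assumes extensionality: "(\<forall>z. z \<epsilon> x \<longleftrightarrow> z \<epsilon> y) \<Longrightarrow> x = y"
    and foundation: "(\<exists>y. y \<epsilon> x) \<Longrightarrow> \<exists>y. y \<epsilon> x \<and> \<not> (\<exists>z. z \<epsilon> x \<and> z \<epsilon> y)"
    and pairing: "\<exists>p. \<forall>z. z \<epsilon> p \<longleftrightarrow> z = a \<or> z = b"
    and union: "\<exists>u. \<forall>z. z \<epsilon> u \<longleftrightarrow> (\<exists>y. y \<epsilon> x \<and> z \<epsilon> y)"
    and power_set: "\<exists>p. \<forall>z. z \<epsilon> p \<longleftrightarrow> subset z x"
    and infinity: "\<exists>w. is_inductive w"
    and separation: "\<exists>b. \<forall>z. z \<epsilon> b \<longleftrightarrow> z \<epsilon> a \<and> sat mem (v(0 := z)) p"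
    and replacement:
      "(\<forall>x y y'. x \<epsilon> a \<and> sat mem (v(0 := x, 1 := y)) p \<and> sat mem (v(0 := x, 1 := y')) p
          \<longrightarrow> y = y') \<Longrightarrow>
       \<exists>b. \<forall>y. y \<epsilon> b \<longleftrightarrow> (\<exists>x. x \<epsilon> a \<and> sat mem (v(0 := x, 1 := y)) p)"

end

theory Submission
  imports Defs
begin

text \<open>
  The colouring \<open>c\<close> of \<open>[X]\<^bsup><\<omega>\<^esup>\<close> that witnesses \<open>H\<^sub>2\<close>-finiteness already witnesses
  \<open>R\<^sup>2\<close>-finiteness after restriction to \<open>[X]\<^sup>2\<close>. Indeed, let \<open>Y \<subseteq> X\<close> be infinite, fix \<open>x \<in> Y\<close>, and
  let the star at \<open>x\<close> be \<open>Y' = {{x, z} | z \<in> Y, z \<noteq> x}\<close>. It is infinite, because \<open>{x, z} \<mapsto> z\<close> is a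
  bijection onto \<open>Y\<close> minus a point. Moreover \<open>FS\<^bsub>\<le>2\<^esub>(Y') \<subseteq> [Y]\<^sup>2\<close>: the elements of \<open>Y'\<close> are pairs,
  and in the sum of two distinct ones the common point \<open>x\<close> cancels,
  \<open>{x, z} \<triangle> {x, z'} = {z, z'}\<close>. So if \<open>c\<close> were constant on \<open>[Y]\<^sup>2\<close>, it would be constant on
  \<open>FS\<^bsub>\<le>2\<^esub>(Y')\<close>, against the choice of \<open>c\<close>. No choice is used beyond picking one \<open>x\<close>.

  What remains is to carry this out inside a model of first-order \<open>ZF\<close>: the sets \<open>[X]\<^sup>2\<close>, \<open>Y'\<close> and
  the restriction of \<open>c\<close> come from separation (\<open>pairs_exist\<close>, \<open>restriction_exists\<close>), and pairs are
  finite and stars infinite in the sense of the model (\<open>finite_upair\<close>, \<open>finite_if_finite_star\<close>).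
  Both finiteness facts rest on the closure of finiteness under adding one point
  (\<open>finite_adjoin\<close>).
\<close>

section \<open>Formulas for unordered and ordered pairs\<close>

abbreviation Ex :: "nat \<Rightarrow> fm \<Rightarrow> fm" where
  "Ex i p \<equiv> Neg (All i (Neg p))"

abbreviation Disj :: "fm \<Rightarrow> fm \<Rightarrow> fm" where
  "Disj p q \<equiv> Neg (Conj (Neg p) (Neg q))"

abbreviation Iff :: "fm \<Rightarrow> fm \<Rightarrow> fm" where
  "Iff p q \<equiv> Conj (Neg (Conj p (Neg q))) (Neg (Conj q (Neg p)))"

text \<open>
  In the next two formulas the bound variables exceed \<open>i + j + k\<close>, so that they never capture
  \<open>i\<close>, \<open>j\<close> or \<open>k\<close>.
\<close>

definition Upair :: "nat \<Rightarrow> nat \<Rightarrow> nat \<Rightarrow> fm" where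
  "Upair i j k = (let z = Suc (i + j + k) in
     All z (Iff (Mem z k) (Disj (Equal z i) (Equal z j))))"

definition Opair :: "nat \<Rightarrow> nat \<Rightarrow> nat \<Rightarrow> fm" where
  "Opair i j k = (let s = Suc (i + j + k); d = Suc s in
     Ex s (Ex d (Conj (Upair i i s) (Conj (Upair i j d) (Upair s d k)))))"

context set_structure
begin

lemma sat_Upair [simp]: "sat mem v (Upair i j k) \<longleftrightarrow> is_upair (v i) (v j) (v k)"
  by (auto simp: Upair_def is_upair_def Let_def)

lemma sat_Opair [simp]: "sat mem v (Opair i j k) \<longleftrightarrow> is_opair (v i) (v j) (v k)"
  by (auto simp: Opair_def is_opair_def Let_def)

end

section \<open>Elementary set existence\<close>

context ZF
begin

definition upair :: "'a \<Rightarrow> 'a \<Rightarrow> 'a" where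
  "upair a b = (SOME p. is_upair a b p)"

definition opair :: "'a \<Rightarrow> 'a \<Rightarrow> 'a" where
  "opair a b = upair (upair a a) (upair a b)"

lemma mem_upair [simp]: "z \<epsilon> upair a b \<longleftrightarrow> z = a \<or> z = b"
proof -
  have "\<exists>p. is_upair a b p"
    unfolding is_upair_def by (rule pairing)
  hence "is_upair a b (upair a b)"
    unfolding upair_def by (rule someI_ex)
  thus ?thesis by (simp add: is_upair_def)
qed

lemma is_upair_iff: "is_upair a b p \<longleftrightarrow> p = upair a b"
  by (auto simp: is_upair_def intro: extensionality)

lemma is_opair_iff: "is_opair a b p \<longleftrightarrow> p = opair a b"
  by (simp add: is_opair_def is_upair_iff opair_def)

lemma maps_to_iff: "maps_to f a b \<longleftrightarrow> opair a b \<epsilon> f"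
  by (simp add: maps_to_def is_opair_iff)

lemma upair_eq_iff: "upair a b = upair c d \<longleftrightarrow> a = c \<and> b = d \<or> a = d \<and> b = c"
proof
  assume "upair a b = upair c d"
  hence "z = a \<or> z = b \<longleftrightarrow> z = c \<or> z = d" for z
    by (metis mem_upair)
  thus "a = c \<and> b = d \<or> a = d \<and> b = c" by metis
qed (auto intro: extensionality)

lemma opair_eq_iff [simp]: "opair a b = opair c d \<longleftrightarrow> a = c \<and> b = d"
  by (auto simp: opair_def upair_eq_iff)

lemma not_mem_self: "\<not> x \<epsilon> x"
  using foundation[of "upair x x"] by auto

lemma adjoin_exists: "\<exists>y. \<forall>z. z \<epsilon> y \<longleftrightarrow> z \<epsilon> x \<or> z = a"
proof -
  have "(\<exists>y. y \<epsilon> upair x (upair a a) \<and> z \<epsilon> y) \<longleftrightarrow> z \<epsilon> x \<or> z = a" for z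
    by auto
  thus ?thesis using union[of "upair x (upair a a)"] by simp
qed

lemma pairs_exist: "\<exists>D. is_pairs X D"
proof -
  obtain P where P: "\<And>z. z \<epsilon> P \<longleftrightarrow> subset z X"
    using power_set[of X] by blast
  have "\<exists>D. \<forall>z. z \<epsilon> D \<longleftrightarrow> subset z X \<and> (\<exists>a b. a \<noteq> b \<and> is_upair a b z)"
    using separation[of P v "Ex 1 (Ex 2 (Conj (Neg (Equal 1 2)) (Upair 1 2 0)))" for v]
    by (simp add: P)
  thus ?thesis by (simp add: is_pairs_def)
qed

lemma mem_pairs:
  assumes "is_pairs X D"
  shows "z \<epsilon> D \<longleftrightarrow> (\<exists>a b. a \<epsilon> X \<and> b \<epsilon> X \<and> a \<noteq> b \<and> z = upair a b)"
  unfolding assms[unfolded is_pairs_def is_upair_iff subset_def, rule_format]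
  by (metis mem_upair)

lemma restriction_exists: "\<exists>g. \<forall>p. p \<epsilon> g \<longleftrightarrow> p \<epsilon> f \<and> (\<exists>a k. a \<epsilon> D \<and> p = opair a k)"
  using separation[of f "\<lambda>_. D" "Ex 2 (Ex 3 (Conj (Mem 2 1) (Opair 2 3 0)))"]
  by (simp add: is_opair_iff)

section \<open>Finite sets inside the model\<close>

lemma in_omega_succ:
  assumes "in_omega n" and "is_succ n m"
  shows "in_omega m"
  unfolding in_omega_def
proof (intro allI impI)
  fix w assume w: "is_inductive w"
  with assms(1) have "n \<epsilon> w" by (simp add: in_omega_def)
  with w obtain m' where "is_succ n m'" "m' \<epsilon> w"
    by (auto simp: is_inductive_def)
  moreover have "m' = m"
    using \<open>is_succ n m'\<close> assms(2) by (auto simp: is_succ_def intro: extensionality)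
  ultimately show "m \<epsilon> w" by simp
qed

lemma finite_empty:
  assumes "is_empty x"
  shows "is_finite x"
proof -
  have "in_omega x"
    using assms unfolding in_omega_def is_inductive_def is_empty_def
    by (metis extensionality)
  moreover have "is_bijection x x x"
    using assms by (simp add: is_bijection_def is_function_def is_empty_def)
  ultimately show ?thesis unfolding is_finite_def by blast
qed

text \<open>
  A bijection of \<open>x\<close> with \<open>n\<close> extends to one of \<open>x \<union> {a}\<close> with \<open>n \<union> {n}\<close> by sending \<open>a\<close> to \<open>n\<close>;
  foundation guarantees \<open>n \<notin> n\<close>.
\<close>

lemma finite_adjoin:
  assumes "is_finite x" and y: "\<And>z. z \<epsilon> y \<longleftrightarrow> z \<epsilon> x \<or> z = a"
  shows "is_finite y"
proof (cases "a \<epsilon> x")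
  case True
  with y have "y = x" by (auto intro: extensionality)
  with assms(1) show ?thesis by simp
next
  case False
  obtain n f where n: "in_omega n" and f: "is_bijection f x n"
    using assms(1) by (auto simp: is_finite_def)
  obtain m where m: "\<And>z. z \<epsilon> m \<longleftrightarrow> z \<epsilon> n \<or> z = n"
    using adjoin_exists[of n n] by blast
  obtain g where g: "\<And>p. p \<epsilon> g \<longleftrightarrow> p \<epsilon> f \<or> p = opair a n"
    using adjoin_exists[of f "opair a n"] by blast
  have f_sub: "b \<epsilon> x \<and> k \<epsilon> n" if "opair b k \<epsilon> f" for b k
    using f that unfolding is_bijection_def is_function_def is_opair_iff
    by (metis opair_eq_iff)
  have g_iff: "opair b k \<epsilon> g \<longleftrightarrow> opair b k \<epsilon> f \<or> b = a \<and> k = n" for b k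
    by (simp add: g)
  have "is_bijection g y m"
    unfolding is_bijection_def is_function_def maps_to_iff is_opair_iff
  proof (intro conjI allI impI)
    fix p assume "p \<epsilon> g"
    thus "\<exists>b k. b \<epsilon> y \<and> k \<epsilon> m \<and> p = opair b k"
      using f unfolding g is_bijection_def is_function_def is_opair_iff y m by blast
  next
    fix b assume "b \<epsilon> y"
    show "\<exists>!k. opair b k \<epsilon> g"
    proof (cases "b = a")
      case True
      with False f_sub show ?thesis unfolding g_iff by blast
    next
      case ne: False
      with \<open>b \<epsilon> y\<close> y have "b \<epsilon> x" by blast
      with f have "\<exists>!k. opair b k \<epsilon> f"
        by (simp add: is_bijection_def is_function_def maps_to_iff)
      with ne show ?thesis unfolding g_iff by simp
    qed
  next
    fix k assume "k \<epsilon> m"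
    show "\<exists>!b. opair b k \<epsilon> g"
    proof (cases "k = n")
      case True
      with not_mem_self f_sub show ?thesis unfolding g_iff by blast
    next
      case ne: False
      with \<open>k \<epsilon> m\<close> m have "k \<epsilon> n" by blast
      with f have "\<exists>!b. opair b k \<epsilon> f"
        by (simp add: is_bijection_def maps_to_iff)
      with ne show ?thesis unfolding g_iff by simp
    qed
  qed
  moreover have "in_omega m"
    using in_omega_succ[OF n] m by (simp add: is_succ_def)
  ultimately show ?thesis unfolding is_finite_def by blast
qed

lemma finite_upair: "is_finite (upair a b)"
proof -
  obtain e where "is_empty e"
    using infinity by (auto simp: is_inductive_def)
  hence "is_finite (upair a a)"
    using finite_adjoin[of e "upair a a" a] finite_empty by (simp add: is_empty_def)
  thus ?thesis
    using finite_adjoin[of "upair a a" "upair a b" b] by simp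
qed

text \<open>
  Precomposing a bijection of \<open>{{x, z} | z \<in> Z}\<close> with the injection \<open>z \<mapsto> {x, z}\<close> counts \<open>Z\<close>. The
  composite is obtained as a set by replacing each element \<open>({x, z}, m)\<close> of the given bijection by
  \<open>(z, m)\<close>.
\<close>

lemma finite_if_finite_upair_image:
  assumes fin: "is_finite W" and W: "\<And>w. w \<epsilon> W \<longleftrightarrow> (\<exists>z. z \<epsilon> Z \<and> w = upair x z)"
  shows "is_finite Z"
proof -
  obtain n f where n: "in_omega n" and f: "is_bijection f W n"
    using fin by (auto simp: is_finite_def)
  have inj: "upair x z = upair x z' \<longleftrightarrow> z = z'" for z z'
    by (auto simp: upair_eq_iff)
  \<comment> \<open>Variables: 0 the element \<open>p\<close> of \<open>f\<close>, 1 its replacement \<open>q\<close>, 2 the parameter \<open>x\<close>; bound are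
    3 for \<open>z\<close>, 4 for \<open>m\<close> and 5 for \<open>{x, z}\<close>.\<close>
  define \<phi> where
    "\<phi> = Ex 3 (Ex 4 (Ex 5 (Conj (Upair 2 3 5) (Conj (Opair 5 4 0) (Opair 3 4 1)))))"
  have \<phi>: "sat mem ((\<lambda>_. x)(0 := p, 1 := q)) \<phi> \<longleftrightarrow>
      (\<exists>z m. p = opair (upair x z) m \<and> q = opair z m)" for p q
    by (simp add: \<phi>_def is_upair_iff is_opair_iff)
  have functional: "q = q'"
    if "\<exists>z m. p = opair (upair x z) m \<and> q = opair z m"
      and "\<exists>z m. p = opair (upair x z) m \<and> q' = opair z m" for p q q'
    using that by (auto simp: inj)
  have "\<exists>g. \<forall>q. q \<epsilon> g \<longleftrightarrow> (\<exists>p. p \<epsilon> f \<and> (\<exists>z m. p = opair (upair x z) m \<and> q = opair z m))"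
    using replacement[of f "\<lambda>_. x" \<phi>] functional unfolding \<phi> by blast
  then obtain g
    where g: "\<And>q. q \<epsilon> g \<longleftrightarrow> (\<exists>z m. opair (upair x z) m \<epsilon> f \<and> q = opair z m)"
    by blast
  have g_iff: "opair z m \<epsilon> g \<longleftrightarrow> opair (upair x z) m \<epsilon> f" for z m
    by (auto simp: g)
  have f_sub: "w \<epsilon> W \<and> m \<epsilon> n" if "opair w m \<epsilon> f" for w m
    using f that unfolding is_bijection_def is_function_def is_opair_iff
    by (metis opair_eq_iff)
  have "is_bijection g Z n"
    unfolding is_bijection_def is_function_def maps_to_iff is_opair_iff
  proof (intro conjI allI impI)
    fix q assume "q \<epsilon> g"
    then obtain z m where zm: "opair (upair x z) m \<epsilon> f" "q = opair z m"
      by (auto simp: g)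
    with f_sub[OF zm(1)] show "\<exists>z m. z \<epsilon> Z \<and> m \<epsilon> n \<and> q = opair z m"
      unfolding W inj by blast
  next
    fix z assume "z \<epsilon> Z"
    with W have "upair x z \<epsilon> W" by blast
    with f show "\<exists>!m. opair z m \<epsilon> g"
      by (simp add: is_bijection_def is_function_def maps_to_iff g_iff)
  next
    fix m assume "m \<epsilon> n"
    with f have ex1: "\<exists>!w. opair w m \<epsilon> f"
      by (simp add: is_bijection_def maps_to_iff)
    then obtain w where w: "opair w m \<epsilon> f" by blast
    with f_sub[OF w] obtain z where "opair (upair x z) m \<epsilon> f"
      unfolding W by blast
    with ex1 inj show "\<exists>!z. opair z m \<epsilon> g"
      unfolding g_iff by blast
  qed
  with n show ?thesis unfolding is_finite_def by blast
qed

section \<open>Stars in the set of pairs\<close>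

definition is_star :: "'a \<Rightarrow> 'a \<Rightarrow> 'a \<Rightarrow> bool" where
  "is_star x Y W \<longleftrightarrow> (\<forall>w. w \<epsilon> W \<longleftrightarrow> (\<exists>z. z \<epsilon> Y \<and> z \<noteq> x \<and> w = upair x z))"

text \<open>The star consists of the pairs in \<open>[Y]\<^sup>2\<close> that contain \<open>x\<close>, so separation yields it.\<close>

lemma star_exists:
  assumes "x \<epsilon> Y"
  shows "\<exists>W. is_star x Y W"
proof -
  obtain D where D: "is_pairs Y D" using pairs_exist by blast
  obtain W where W: "\<And>w. w \<epsilon> W \<longleftrightarrow> w \<epsilon> D \<and> x \<epsilon> w"
    using separation[of D "\<lambda>_. x" "Mem 1 0"] by auto
  have "is_star x Y W"
    unfolding is_star_def W mem_pairs[OF D] using assms by (auto simp: upair_eq_iff)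
  thus ?thesis by blast
qed

lemma finite_if_finite_star:
  assumes "x \<epsilon> Y" and "is_star x Y W" and "is_finite W"
  shows "is_finite Y"
proof -
  obtain Z where Z: "\<And>z. z \<epsilon> Z \<longleftrightarrow> z \<epsilon> Y \<and> z \<noteq> x"
    using separation[of Y "\<lambda>_. x" "Neg (Equal 0 1)"] by auto
  have "is_finite Z"
    using assms(2,3) finite_if_finite_upair_image[of W Z x] by (simp add: is_star_def Z)
  moreover have "z \<epsilon> Y \<longleftrightarrow> z \<epsilon> Z \<or> z = x" for z
    using Z assms(1) by blast
  ultimately show ?thesis by (rule finite_adjoin)
qed

text \<open>
  A sum of one element of the star is a pair containing \<open>x\<close>; a sum of two is a pair by the
  cancellation \<open>{x, z} \<triangle> {x, z'} = {z, z'}\<close>.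
\<close>

lemma FS_star_subset_pairs:
  assumes "x \<epsilon> Y" and W: "is_star x Y W" and S: "is_FS_le2 W S" and D: "is_pairs Y D"
  shows "subset S D"
  unfolding subset_def
proof (intro allI impI)
  fix s assume "s \<epsilon> S"
  with S obtain F where F: "subset F W" and sum: "is_sum_le2 F s"
    by (auto simp: is_FS_le2_def)
  from sum consider (one) "s \<epsilon> F"
    | (two) y y' where "y \<noteq> y'" "y \<epsilon> F" "y' \<epsilon> F" "is_symdiff y y' s"
    by (auto simp: is_sum_le2_def is_upair_iff)
  thus "s \<epsilon> D"
  proof cases
    case one
    with F W obtain z where "z \<epsilon> Y" "z \<noteq> x" "s = upair x z"
      by (auto simp: subset_def is_star_def)
    with \<open>x \<epsilon> Y\<close> show ?thesis unfolding mem_pairs[OF D] by blast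
  next
    case two
    with F W obtain z z' where z: "z \<epsilon> Y" "z \<noteq> x" "y = upair x z"
      and z': "z' \<epsilon> Y" "z' \<noteq> x" "y' = upair x z'"
      unfolding subset_def is_star_def by blast
    have "z \<noteq> z'" using two(1) z z' by blast
    have "s = upair z z'"
      using two(4) z z' \<open>z \<noteq> z'\<close> by (intro extensionality) (auto simp: is_symdiff_def)
    with z z' \<open>z \<noteq> z'\<close> show ?thesis unfolding mem_pairs[OF D] by blast
  qed
qed

section \<open>Restricting the colouring\<close>

lemma H2_finite_imp_R2_finite:
  assumes "H2_finite X"
  shows "R2_finite X"
proof -
  obtain P c t where P: "is_finsets X P" and t: "is_two t" and c: "is_function c P t"
    and H2: "\<And>Y. subset Y P \<Longrightarrow> \<not> is_finite Y \<Longrightarrow> \<exists>S. is_FS_le2 Y S \<and> \<not> constant_on c S"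
    using assms unfolding H2_finite_def is_colouring_def by blast
  obtain D where D: "is_pairs X D" using pairs_exist by blast
  have D_sub_P: "z \<epsilon> P" if "z \<epsilon> D" for z
    using that P finite_upair unfolding mem_pairs[OF D] is_finsets_def
    by (auto simp: subset_def)
  obtain c' where c': "\<And>p. p \<epsilon> c' \<longleftrightarrow> p \<epsilon> c \<and> (\<exists>a k. a \<epsilon> D \<and> p = opair a k)"
    using restriction_exists by blast
  have c'_iff: "opair a k \<epsilon> c' \<longleftrightarrow> opair a k \<epsilon> c \<and> a \<epsilon> D" for a k
    by (auto simp: c')
  have "is_function c' D t"
    unfolding is_function_def maps_to_iff is_opair_iff
  proof (intro conjI allI impI)
    fix p assume p: "p \<epsilon> c'"
    then obtain a k where ak: "a \<epsilon> D" "p = opair a k" by (auto simp: c')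
    moreover from p c obtain a' k' where "k' \<epsilon> t" "p = opair a' k'"
      unfolding c' is_function_def is_opair_iff by blast
    ultimately show "\<exists>a k. a \<epsilon> D \<and> k \<epsilon> t \<and> p = opair a k" by auto
  next
    fix a assume "a \<epsilon> D"
    with c D_sub_P show "\<exists>!k. opair a k \<epsilon> c'"
      by (simp add: is_function_def maps_to_iff c'_iff)
  qed
  with t have "is_colouring c' D" unfolding is_colouring_def by blast
  moreover have "\<exists>S. is_pairs Y S \<and> \<not> constant_on c' S"
    if Y: "subset Y X" "\<not> is_finite Y" for Y
  proof -
    obtain E where E: "is_pairs Y E" using pairs_exist by blast
    have "\<not> constant_on c' E"
    proof
      assume "constant_on c' E"
      then obtain k where k: "\<And>s. s \<epsilon> E \<Longrightarrow> opair s k \<epsilon> c'"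
        by (auto simp: constant_on_def maps_to_iff)
      obtain x where x: "x \<epsilon> Y"
        using Y(2) finite_empty by (auto simp: is_empty_def)
      obtain W where W: "is_star x Y W" using star_exists[OF x] by blast
      have "subset W P"
        unfolding subset_def
      proof (intro allI impI)
        fix w assume "w \<epsilon> W"
        with W obtain z where "z \<epsilon> Y" "z \<noteq> x" "w = upair x z"
          by (auto simp: is_star_def)
        with x Y(1) have "w \<epsilon> D"
          unfolding mem_pairs[OF D] subset_def by blast
        thus "w \<epsilon> P" by (rule D_sub_P)
      qed
      moreover have "\<not> is_finite W"
        using finite_if_finite_star[OF x W] Y(2) by blast
      ultimately obtain S where S: "is_FS_le2 W S" "\<not> constant_on c S"
        using H2 by blast
      have "opair s k \<epsilon> c" if "s \<epsilon> S" for s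
        using FS_star_subset_pairs[OF x W S(1) E] that k c'_iff by (auto simp: subset_def)
      with S(2) show False by (auto simp: constant_on_def maps_to_iff)
    qed
    with E show ?thesis by blast
  qed
  ultimately show ?thesis using D unfolding R2_finite_def by blast
qed

end

theorem theorem3p8:
  fixes mem :: "'m \<Rightarrow> 'm \<Rightarrow> bool"
  assumes "ZF mem"
  shows "\<forall>X. set_structure.H2_finite mem X \<longrightarrow> set_structure.R2_finite mem X"
  using ZF.H2_finite_imp_R2_finite[OF assms] by blast

end
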